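(* For every real $\alpha$ and every positive integer $n$, every graph on $n$ vertices with at least $\frac{n^2}{8} + 10^{10}\alpha n$ edges contains either a copy of $K_4$ or an independent set of size greater than $\alpha$. *)

theory Defs
  imports Complex_Main "HOL-Library.Ramsey"
begin

text \<open>A finite simple graph is given by a finite vertex set \<open>V\<close> and an edge set \<open>E\<close> of
  two-element subsets of \<open>V\<close>. Cliques and independent sets are \<^const>\<open>clique\<close> and
  \<^const>\<open>indep\<close>; a copy of \<open>K\<^sub>4\<close> is a clique on four vertices.\<close>

definition simple_graph :: "'a set \<Rightarrow> 'a set set \<Rightarrow> bool" where
  "simple_graph V E \<longleftrightarrow> finite V \<and> E \<subseteq> [V]\<^bsup>2\<^esup>"

end

theory Submission
  imports Defs
begin

text \<open>Let \<open>G\<close> be \<open>K\<^sub>4\<close>-free with independence number at most \<open>\<alpha>\<close>. Adjacent vertices have at most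
  \<open>\<alpha>\<close> common neighbours, hence for every vertex set \<open>X\<close> all but \<open>\<alpha>\<close> vertices have at most
  \<open>(|X| + \<alpha>) / 2\<close> neighbours in \<open>X\<close>. Deleting vertices of low degree, one may assume that the minimum
  degree is at least \<open>n / 4 + 3 \<alpha>\<close> and that \<open>\<alpha>\<close> is tiny compared with \<open>n\<close>. Call the set of vertices with
  more than \<open>\<alpha>\<close> neighbours in \<open>X\<close> the support of \<open>X\<close>; by the two degree bounds it has at least about
  \<open>n / 2\<close> vertices. Passing from \<open>X\<close> to \<open>X \<inter> N(y)\<close> removes \<open>N(y)\<close> from the support, and a few such
  steps bring the support down to almost \<open>n / 2\<close> while \<open>X\<close> keeps a constant fraction of all vertices.
  The support is then nearly independent, which yields a nearly balanced bipartition in which every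
  vertex has few neighbours on its own side, and then even at most \<open>\<alpha>\<close>. So each part
  forces the other one to have more than \<open>n / 2\<close> vertices, a contradiction.\<close>

section \<open>Degrees and common neighbourhoods in K_4-free graphs\<close>

locale K4_free_graph =
  fixes V :: "'a set" and E :: "'a set set" and \<alpha> :: real
  assumes simple: "simple_graph V E"
    and K4_free: "\<And>K. K \<subseteq> V \<Longrightarrow> card K = 4 \<Longrightarrow> \<not> clique K E"
    and indep_le: "\<And>I. I \<subseteq> V \<Longrightarrow> indep I E \<Longrightarrow> real (card I) \<le> \<alpha>"
begin

definition nb :: "'a set \<Rightarrow> 'a \<Rightarrow> 'a set" where
  "nb X v = {x \<in> X. {x, v} \<in> E}"

abbreviation d :: "'a set \<Rightarrow> 'a \<Rightarrow> real" where
  "d X v \<equiv> real (card (nb X v))"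

lemma finite_V: "finite V"
  using simple by (simp add: simple_graph_def)

lemma finite_sub: "X \<subseteq> V \<Longrightarrow> finite X"
  using finite_V finite_subset by blast

lemma edgeD: "{u, v} \<in> E \<Longrightarrow> u \<noteq> v \<and> u \<in> V \<and> v \<in> V"
  using simple by (fastforce simp: simple_graph_def nsets_def card_2_iff)

lemma nb_subset: "nb X v \<subseteq> X"
  by (auto simp: nb_def)

lemma alpha_nonneg: "0 \<le> \<alpha>"
  using indep_le[of "{}"] by (simp add: indep_def)

lemma d_mono: "X \<subseteq> Y \<Longrightarrow> Y \<subseteq> V \<Longrightarrow> d X v \<le> d Y v"
  by (auto simp: nb_def intro!: card_mono finite_sub)

lemma d_le_card: "X \<subseteq> V \<Longrightarrow> d X v \<le> real (card X)"
  by (simp add: card_mono finite_sub nb_subset)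

lemma d_subadditive:
  assumes "Z \<subseteq> X \<union> Y" "X \<subseteq> V" "Y \<subseteq> V"
  shows "d Z v \<le> d X v + d Y v"
proof -
  have "card (nb Z v) \<le> card (nb X v \<union> nb Y v)"
    using assms by (intro card_mono) (auto simp: nb_def intro: finite_sub)
  also have "\<dots> \<le> card (nb X v) + card (nb Y v)"
    by (rule card_Un_le)
  finally show ?thesis
    by linarith
qed

lemma sum_d_swap:
  assumes "X \<subseteq> V" "Y \<subseteq> V"
  shows "(\<Sum>x\<in>X. d Y x) = (\<Sum>y\<in>Y. d X y)"
proof -
  have "finite X" "finite Y"
    using assms finite_sub by auto
  then have "d Y x = (\<Sum>y\<in>Y. if {x, y} \<in> E then 1 else 0)"
    "d X x = (\<Sum>y\<in>X. if {x, y} \<in> E then 1 else 0)" for x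
    by (auto simp: nb_def insert_commute sum.If_cases Int_def)
  then show ?thesis
    using sum.swap[of "\<lambda>x y. if {x, y} \<in> E then 1 else 0::real" Y X]
    by (simp add: insert_commute)
qed

text \<open>An edge among the common neighbours of \<open>u\<close> and \<open>v\<close> would
  complete a K_4, so these neighbours form an independent set.\<close>

lemma d_nb_le:
  assumes "X \<subseteq> V" "{u, v} \<in> E"
  shows "d (nb X u) v \<le> \<alpha>"
proof -
  have "indep (nb (nb X u) v) E"
    unfolding indep_def
  proof (intro ballI impI notI)
    fix x y assume xy: "x \<in> nb (nb X u) v" "y \<in> nb (nb X u) v" "x \<noteq> y" "{x, y} \<in> E"
    then have e: "{x, u} \<in> E" "{y, u} \<in> E" "{x, v} \<in> E" "{y, v} \<in> E"
      by (auto simp: nb_def)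
    have "card {u, v, x, y} = 4"
      using edgeD[OF e(1)] edgeD[OF e(2)] edgeD[OF e(3)] edgeD[OF e(4)] edgeD[OF assms(2)] xy(3)
      by (auto simp: card_insert_if)
    moreover have "clique {u, v, x, y} E"
      using e xy(4) assms(2) by (auto simp: clique_def insert_commute)
    moreover have "{u, v, x, y} \<subseteq> V"
      using edgeD[OF assms(2)] edgeD[OF xy(4)] by auto
    ultimately show False
      using K4_free by blast
  qed
  then show ?thesis
    using indep_le assms nb_subset by (meson subset_trans)
qed

lemma d_edge_le:
  assumes "X \<subseteq> V" "{u, v} \<in> E"
  shows "d X u + d X v \<le> real (card X) + \<alpha>"
proof -
  have fin: "finite (nb X u)" "finite (nb X v)"
    using assms(1) finite_sub nb_subset by (meson subset_trans)+
  have "nb X u \<inter> nb X v = nb (nb X u) v"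
    by (auto simp: nb_def)
  then have "card (nb X u) + card (nb X v) = card (nb X u \<union> nb X v) + card (nb (nb X u) v)"
    using card_Un_Int[OF fin] by simp
  moreover have "card (nb X u \<union> nb X v) \<le> card X"
    using assms(1) by (intro card_mono finite_sub) (auto simp: nb_def)
  ultimately show ?thesis
    using d_nb_le[OF assms] by linarith
qed

text \<open>By \<open>d_edge_le\<close>, two adjacent vertices cannot both exceed the
  threshold.\<close>

lemma card_heavy_le:
  assumes "X \<subseteq> V"
  shows "real (card {v \<in> V. d X v > (card X + \<alpha>) / 2}) \<le> \<alpha>"
proof (rule indep_le)
  show "indep {v \<in> V. d X v > (card X + \<alpha>) / 2} E"
    unfolding indep_def using d_edge_le[OF assms] by fastforce
qed auto

text \<open>The at most \<alpha> heavy vertices are charged all of \<open>X\<close>, the others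
  about half of it.\<close>

lemma sum_d_le:
  assumes "X \<subseteq> V" "Z \<subseteq> V"
  shows "(\<Sum>v\<in>Z. d X v) \<le> card Z * ((card X + \<alpha>) / 2) + \<alpha> * card X"
proof -
  define H where "H = {v \<in> V. d X v > (card X + \<alpha>) / 2}"
  have fin: "finite Z" "finite H"
    using assms finite_sub by (auto simp: H_def finite_V)
  have "(\<Sum>v\<in>Z. d X v) = (\<Sum>v\<in>Z - H. d X v) + (\<Sum>v\<in>Z \<inter> H. d X v)"
    by (metis fin(1) sum.Int_Diff add.commute)
  also have "(\<Sum>v\<in>Z - H. d X v) \<le> card (Z - H) * ((card X + \<alpha>) / 2)"
    by (rule sum_bounded_above) (use assms in \<open>auto simp: H_def\<close>)
  also have "\<dots> \<le> card Z * ((card X + \<alpha>) / 2)"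
    using fin alpha_nonneg by (intro mult_right_mono) (auto intro: card_mono)
  also have "(\<Sum>v\<in>Z \<inter> H. d X v) \<le> card (Z \<inter> H) * real (card X)"
    by (rule sum_bounded_above) (use d_le_card[OF assms(1)] in auto)
  also have "\<dots> \<le> \<alpha> * card X"
  proof (rule mult_right_mono)
    have "card (Z \<inter> H) \<le> card H"
      using fin by (intro card_mono) auto
    then show "real (card (Z \<inter> H)) \<le> \<alpha>"
      using card_heavy_le[OF assms(1)] unfolding H_def by linarith
  qed auto
  finally show ?thesis
    by simp
qed

end

section \<open>Averaging under a minimum degree condition\<close>

locale dense_K4_free_graph = K4_free_graph +
  fixes n :: real
  defines n_def: "n \<equiv> real (card V)"
  assumes alpha_pos: "0 < \<alpha>"
    and alpha_le: "10 ^ 10 * \<alpha> \<le> n"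
    and min_degree: "\<And>v. v \<in> V \<Longrightarrow> n / 4 + 3 * \<alpha> \<le> d V v"
begin

lemma n_pos: "0 < n"
  using alpha_pos alpha_le by simp

lemma card_le_n: "X \<subseteq> V \<Longrightarrow> card X \<le> n"
  unfolding n_def by (simp add: card_mono finite_V)

lemma card_compl: "X \<subseteq> V \<Longrightarrow> real (card (V - X)) = n - card X"
  unfolding n_def using card_Diff_subset[of X V] card_mono[OF finite_V, of X] finite_sub
  by (simp add: of_nat_diff)

text \<open>With at least \<open>n / 10\<^sup>6\<close> vertices in \<open>X\<close>, all terms involving \<open>\<alpha>\<close> are at most
  \<open>n |X| / 10\<^sup>4\<close>.\<close>

lemma alpha_le_card: "n / 10 ^ 6 \<le> real (card X) \<Longrightarrow> 10 ^ 4 * \<alpha> \<le> card X"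
  using alpha_le by simp

lemma sum_d_le_half:
  assumes "X \<subseteq> V" "Z \<subseteq> V" "n / 10 ^ 6 \<le> card X"
  shows "(\<Sum>v\<in>Z. d X v) \<le> card X * (card Z / 2 + n / 10 ^ 4)"
proof -
  have "card Z * \<alpha> \<le> n * (card X / 10 ^ 4)"
    using alpha_le_card[OF assms(3)] card_le_n[OF assms(2)] alpha_pos n_pos
    by (intro mult_mono) auto
  moreover have "\<alpha> * card X \<le> (n / 10 ^ 10) * card X"
    using alpha_le by (intro mult_right_mono) auto
  moreover have "0 \<le> n * card X"
    using n_pos by simp
  ultimately show ?thesis
    using sum_d_le[OF assms(1,2)] by (simp add: field_simps)
qed

lemma sum_d_ge: "X \<subseteq> V \<Longrightarrow> card X * (n / 4) \<le> (\<Sum>v\<in>V. d X v)"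
proof -
  assume X: "X \<subseteq> V"
  have "card X * (n / 4) \<le> (\<Sum>x\<in>X. d V x)"
    using X min_degree alpha_pos by (intro sum_bounded_below) (smt (verit) subsetD)
  then show ?thesis
    using sum_d_swap[OF X subset_refl] by simp
qed

section \<open>Supports and rich vertices\<close>

definition supp :: "'a set \<Rightarrow> 'a set" where
  "supp X = {v \<in> V. d X v > \<alpha>}"

text \<open>The fraction 1/5 lies below the density 1/4 forced by the minimum degree, so
  \<open>card_rich_ge\<close> gives many rich vertices even if the support is all of
  \<open>V\<close>.\<close>

definition rich :: "'a set \<Rightarrow> 'a set" where
  "rich X = {v \<in> V. d X v \<ge> card X / 5}"

lemma supp_subset: "supp X \<subseteq> V" and rich_subset: "rich X \<subseteq> V"
  by (auto simp: supp_def rich_def)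

lemma rich_subset_supp:
  assumes "n / 10 ^ 6 \<le> card X"
  shows "rich X \<subseteq> supp X"
  using alpha_le_card[OF assms] alpha_pos by (auto simp: rich_def supp_def)

text \<open>Double counting between \<open>X\<close> and \<open>V\<close>, divided by
  \<open>card X\<close>: the minimum degree bounds the sum from below; from above, \<open>Z\<close>
  is averaged by \<open>sum_d_le_half\<close>, while \<open>Y - Z\<close> and \<open>V - Y\<close>
  use pointwise bounds.\<close>

lemma degree_split:
  fixes s t :: real
  assumes "X \<subseteq> V" "n / 10 ^ 6 \<le> card X" "Z \<subseteq> Y" "Y \<subseteq> V"
    and "\<And>v. v \<in> Y - Z \<Longrightarrow> d X v \<le> card X * t"
    and "\<And>v. v \<in> V - Y \<Longrightarrow> d X v \<le> card X * s"
  shows "n / 4 \<le> card Z / 2 + n / 10 ^ 4 + (card Y - real (card Z)) * t + (n - card Y) * s"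
proof -
  have fin: "finite Y" "finite Z"
    using assms finite_sub by (auto intro: finite_subset)
  have "(\<Sum>v\<in>V. d X v) = (\<Sum>v\<in>V - Y. d X v) + ((\<Sum>v\<in>Y - Z. d X v) + (\<Sum>v\<in>Z. d X v))"
    using sum.subset_diff[OF assms(4) finite_V] sum.subset_diff[OF assms(3) fin(1)] by metis
  also have "(\<Sum>v\<in>V - Y. d X v) \<le> card (V - Y) * (card X * s)"
    by (rule sum_bounded_above) (use assms in auto)
  also have "(\<Sum>v\<in>Y - Z. d X v) \<le> card (Y - Z) * (card X * t)"
    by (rule sum_bounded_above) (use assms in auto)
  also have "(\<Sum>v\<in>Z. d X v) \<le> card X * (card Z / 2 + n / 10 ^ 4)"
    using assms by (intro sum_d_le_half) auto
  also have "real (card (V - Y)) = n - card Y"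
    by (rule card_compl) fact
  also have "real (card (Y - Z)) = card Y - real (card Z)"
    using card_Diff_subset[OF fin(2) assms(3)] card_mono[OF fin(1) assms(3)] by (simp add: of_nat_diff)
  finally have "card X * (n / 4) \<le> card X *
      (card Z / 2 + n / 10 ^ 4 + (card Y - real (card Z)) * t + (n - card Y) * s)"
    using sum_d_ge[OF assms(1)] by (simp add: algebra_simps)
  moreover have "0 < real (card X)"
    using assms(2) n_pos by (smt (verit) divide_pos_pos zero_less_power)
  ultimately show ?thesis
    by (simp add: mult_le_cancel_left_pos)
qed

lemma card_supp_ge:
  assumes "X \<subseteq> V" "n / 10 ^ 6 \<le> card X"
  shows "card (supp X) \<ge> n / 2 - 4 * n / 10 ^ 4"
proof -
  have "n / 4 \<le> card (supp X) / 2 + n / 10 ^ 4 + (card (supp X) - real (card (supp X))) * 0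
      + (n - card (supp X)) * (1 / 10 ^ 4)"
    using assms alpha_le_card[OF assms(2)]
    by (intro degree_split) (auto simp: supp_def)
  then show ?thesis
    by (simp add: field_simps)
qed

text \<open>Once the support has about n/2 vertices, this forces nearly all of them to be
  rich.\<close>

lemma card_rich_ge:
  assumes "X \<subseteq> V" "n / 10 ^ 6 \<le> card X"
  shows "3 / 10 * card (rich X) \<ge> n / 4 - card (supp X) / 5 - 2 * n / 10 ^ 4"
proof -
  have "n / 4 \<le> card (rich X) / 2 + n / 10 ^ 4 + (card (supp X) - real (card (rich X))) * (1 / 5)
      + (n - card (supp X)) * (1 / 10 ^ 4)"
    using assms alpha_le_card[OF assms(2)] rich_subset_supp[OF assms(2)]
    by (intro degree_split) (auto simp: supp_def rich_def)
  then show ?thesis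
    by (simp add: field_simps)
qed

text \<open>A neighbour of \<open>y\<close> has at most \<alpha> neighbours in
  \<open>nb X y\<close>, exactly the cutoff in \<open>supp\<close>.\<close>

lemma card_supp_nb:
  assumes "X \<subseteq> V" "y \<in> V"
  shows "card (supp (nb X y)) + d (supp X) y \<le> card (supp X)"
proof -
  have "supp (nb X y) \<subseteq> supp X"
    using d_mono[OF nb_subset assms(1)] unfolding supp_def by (auto intro: less_le_trans)
  moreover have "supp (nb X y) \<inter> nb (supp X) y = {}"
  proof -
    have "d (nb X y) v \<le> \<alpha>" if "{v, y} \<in> E" for v
      using d_nb_le[OF assms(1)] that by (simp add: insert_commute)
    then show ?thesis
      by (fastforce simp: supp_def nb_def)
  qed
  ultimately have "card (supp (nb X y)) + card (nb (supp X) y) \<le> card (supp X)"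
    using card_Un_disjoint[of "supp (nb X y)" "nb (supp X) y"] finite_sub[OF supp_subset]
    by (metis Un_least card_mono nb_subset rev_finite_subset)
  then show ?thesis
    by simp
qed

text \<open>Otherwise every rich vertex sends more than \<open>n / 4 - m\<close> edges out of the
  support, while averaging allows only about half of the complement; \<open>m\<close> is the value
  at which the two bounds meet.\<close>

lemma ex_rich_large_degree:
  assumes "X \<subseteq> V" "n / 10 ^ 6 \<le> card X"
  shows "\<exists>y\<in>rich X. d (supp X) y \<ge> (card (supp X) - n / 2) / 2 - n / 10 ^ 4"
proof (rule ccontr)
  define m where "m = (card (supp X) - n / 2) / 2 - n / 10 ^ 4"
  assume "\<not> ?thesis"
  then have small: "d (supp X) y < m" if "y \<in> rich X" for y
    using that by (auto simp: m_def)
  let ?P = "rich X" and ?T = "V - supp X"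
  have cP: "n / 10 ^ 6 \<le> card ?P"
    using card_rich_ge[OF assms] card_le_n[OF supp_subset, of X] n_pos by (simp add: field_simps)
  then have pos: "0 < real (card ?P)"
    using n_pos by (smt (verit) divide_pos_pos zero_less_power)
  then have "?P \<noteq> {}" "finite ?P"
    using finite_sub[OF rich_subset] by auto
  have "d ?T y > n / 4 - m" if "y \<in> ?P" for y
    using d_subadditive[of V "supp X" ?T y] small[OF that] min_degree[of y] alpha_pos
      supp_subset[of X] rich_subset[of X] that by fastforce
  then have "(\<Sum>y\<in>?P. n / 4 - m) < (\<Sum>y\<in>?P. d ?T y)"
    using \<open>?P \<noteq> {}\<close> \<open>finite ?P\<close> by (intro sum_strict_mono) auto
  also have "\<dots> = (\<Sum>v\<in>?T. d ?P v)"
    by (rule sum_d_swap) (auto simp: rich_def)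
  also have "\<dots> \<le> card ?P * (card ?T / 2 + n / 10 ^ 4)"
    using cP by (intro sum_d_le_half) (auto simp: rich_def)
  finally have "card ?P * (n / 4 - m) < card ?P * (card ?T / 2 + n / 10 ^ 4)"
    by simp
  then have "n / 4 - m < card ?T / 2 + n / 10 ^ 4"
    using pos by (simp add: mult_less_cancel_left_pos)
  then show False
    using card_compl[OF supp_subset[of X]] by (simp add: m_def field_simps)
qed

text \<open>Each step replaces \<open>X\<close> by the neighbours in \<open>X\<close> of a rich vertex with many neighbours in
  the support; these neighbours leave the support, which halves the excess over \<open>n / 2\<close>.\<close>

lemma ex_small_supp:
  assumes "k \<le> 8"
  shows "\<exists>X\<subseteq>V. n / 5 ^ k \<le> card X \<and> card (supp X) \<le> n / 2 + 2 * n / 10 ^ 4 + n / 2 ^ (k + 1)"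
  using assms
proof (induction k)
  case 0
  show ?case
    using card_le_n[OF supp_subset[of V]] n_pos by (intro exI[of _ V]) (auto simp: n_def)
next
  case (Suc k)
  then obtain X where X: "X \<subseteq> V" "n / 5 ^ k \<le> card X"
    "card (supp X) \<le> n / 2 + 2 * n / 10 ^ 4 + n / 2 ^ (k + 1)"
    by auto
  \<comment> \<open>Since 5^8 = 390625 < 10^6, the averaging bounds remain available.\<close>
  have "(5::real) ^ k \<le> 5 ^ 8"
    using Suc.prems by (intro power_increasing) auto
  then have "n / 10 ^ 6 \<le> n / 5 ^ k"
    using n_pos by (intro divide_left_mono) auto
  with X(2) have large: "n / 10 ^ 6 \<le> card X"
    by linarith
  obtain y where y: "y \<in> rich X" "d (supp X) y \<ge> (card (supp X) - n / 2) / 2 - n / 10 ^ 4"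
    using ex_rich_large_degree[OF X(1) large] by blast
  have "card (supp (nb X y)) + d (supp X) y \<le> card (supp X)"
    using card_supp_nb X(1) y(1) rich_subset by blast
  \<comment> \<open>The excess e over n/2 becomes at most e/2 + n/10^4, a map with fixed point
    2n/10^4.\<close>
  have "card (supp (nb X y)) \<le> n / 2 + 2 * n / 10 ^ 4 + n / 2 ^ (Suc k + 1)"
  proof -
    have "n / 2 ^ (Suc k + 1) = n / 2 ^ (k + 1) / 2"
      by simp
    then show ?thesis
      using X(3) y(2) \<open>card (supp (nb X y)) + d (supp X) y \<le> card (supp X)\<close> by argo
  qed
  moreover have "n / 5 ^ Suc k \<le> card (nb X y)"
  proof -
    have "n / 5 ^ Suc k = n / 5 ^ k / 5"
      by simp
    then show ?thesis
      using X(2) y(1) unfolding rich_def by auto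
  qed
  ultimately show ?case
    using X(1) nb_subset by (metis subset_trans)
qed

section \<open>A nearly balanced bipartition with sparse sides\<close>

text \<open>Take \<open>P = rich X\<close> with \<open>supp X\<close> close to n/2. For rich
  \<open>y\<close>, the support of \<open>nb X y\<close> still has almost n/2 vertices and avoids
  the neighbours of \<open>y\<close>, so \<open>supp X\<close> contains few of these.\<close>

lemma ex_sparse_half:
  obtains P where "P \<subseteq> V" "card P \<ge> n / 2 - n / 200" "card P \<le> n / 2 + n / 200"
    "\<And>y. y \<in> P \<Longrightarrow> d P y \<le> n / 200"
proof -
  \<comment> \<open>Seven steps leave room for one more: \<open>nb X y\<close> then has at least
    n/5^8 vertices.\<close>
  obtain X where X: "X \<subseteq> V" "n / 5 ^ 7 \<le> card X"
    "card (supp X) \<le> n / 2 + 2 * n / 10 ^ 4 + n / 2 ^ (7 + 1)"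
    using ex_small_supp[of 7] by auto
  have large: "n / 10 ^ 6 \<le> card X"
    using X(2) n_pos by simp
  note sub = rich_subset_supp[OF large]
  have ge: "card (rich X) \<ge> n / 2 - n / 200"
    using card_rich_ge[OF X(1) large] X(3) n_pos by simp
  have "card (rich X) \<le> card (supp X)"
    using sub supp_subset finite_sub card_mono by metis
  then have le: "card (rich X) \<le> n / 2 + n / 200"
    using X(3) n_pos by simp
  have "d (rich X) y \<le> n / 200" if y: "y \<in> rich X" for y
  proof -
    have "n / 10 ^ 6 \<le> card (nb X y)"
      using X(2) y n_pos by (simp add: rich_def)
    then have "card (supp (nb X y)) \<ge> n / 2 - 4 * n / 10 ^ 4"
      using X(1) nb_subset card_supp_ge by (metis subset_trans)
    moreover have "card (supp (nb X y)) + d (supp X) y \<le> card (supp X)"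
      using card_supp_nb X(1) y rich_subset by blast
    ultimately show ?thesis
      using d_mono[OF sub supp_subset, of y] X(3) n_pos by simp
  qed
  then show thesis
    using that rich_subset ge le by blast
qed

lemma ex_sparse_bipartition:
  obtains A B where "A \<union> B = V" "A \<inter> B = {}"
    "card A \<le> n / 2 + n / 40" "card B \<le> n / 2 + n / 40"
    "\<And>v. v \<in> A \<Longrightarrow> d A v \<le> n / 25" "\<And>v. v \<in> B \<Longrightarrow> d B v \<le> n / 25"
proof -
  obtain P where P: "P \<subseteq> V" "card P \<ge> n / 2 - n / 200" "card P \<le> n / 2 + n / 200"
    "\<And>y. y \<in> P \<Longrightarrow> d P y \<le> n / 200"
    using ex_sparse_half by metis
  define B where "B = {v \<in> V. d P v > n / 200}"
  define A where "A = V - B"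
  have B_sub: "B \<subseteq> V - P" and A_sub: "A \<subseteq> V" and P_A: "P \<subseteq> A"
    using P(1,4) by (force simp: B_def A_def)+
  have cVP: "real (card (V - P)) = n - card P"
    using P(1) by (rule card_compl)
  have cB: "card B \<le> n / 2 + n / 200"
    using card_mono[OF _ B_sub] finite_V cVP P(2) by simp
  have largeP: "n / 10 ^ 6 \<le> card P"
    using P(2) n_pos by simp
  \<comment> \<open>Vertices outside \<open>B\<close> have at most n/200 neighbours in
    \<open>P\<close>, and n/200 = (99n/200)/99 is at most \<open>card P / 99\<close>.\<close>
  have "n / 4 \<le> card B / 2 + n / 10 ^ 4 + (card B - real (card B)) * 0
      + (n - card B) * (1 / 99)"
    using P largeP B_sub by (intro degree_split[of P]) (auto simp: B_def)
  then have cB': "card B \<ge> n / 2 - n / 40"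
    using n_pos by (simp add: field_simps)
  have cA: "card A = n - card B"
    unfolding A_def using B_sub by (intro card_compl) auto
  have "card (A - P) = card A - real (card P)"
    using card_Diff_subset[OF finite_sub[OF P(1)] P_A] card_mono[OF finite_sub[OF A_sub] P_A]
    by (simp add: of_nat_diff)
  then have cAP: "card (A - P) \<le> n / 40 + n / 200"
    using cA cB' P(2) by linarith
  have ownA: "d A v \<le> n / 25" if "v \<in> A" for v
  proof -
    have "d A v \<le> d P v + d (A - P) v"
      using P(1) A_sub by (intro d_subadditive) auto
    moreover have "d P v \<le> n / 200"
      using that by (auto simp: A_def B_def)
    moreover have "d (A - P) v \<le> card (A - P)"
      using A_sub by (intro d_le_card) auto
    ultimately show ?thesis
      using cAP n_pos by simp
  qed
  \<comment> \<open>Each neighbour \<open>x\<close> of \<open>v\<close> in \<open>P\<close> has few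
    neighbours in \<open>P\<close> and at most \<alpha> in \<open>nb V v\<close>, hence almost n/4
    in \<open>R\<close>. Averaging makes \<open>R\<close> almost all of \<open>V - P\<close>,
    leaving little room for neighbours of \<open>v\<close> there.\<close>
  have ownB: "d B v \<le> n / 25" if v: "v \<in> B" for v
  proof -
    define X where "X = nb P v"
    define R where "R = V - P - nb V v"
    have X: "X \<subseteq> V" "X \<subseteq> P" "n / 200 < card X"
      using v P(1) by (auto simp: X_def B_def nb_def)
    have "n / 4 \<le> n / 200 + \<alpha> + d R x" if "x \<in> X" for x
    proof -
      have "d V x \<le> d P x + d (V - P) x"
        using P(1) by (intro d_subadditive) auto
      moreover have "d (V - P) x \<le> d (nb V v) x + d R x"
        by (intro d_subadditive) (auto simp: R_def nb_def)
      moreover have "d (nb V v) x \<le> \<alpha>"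
        using that by (intro d_nb_le) (auto simp: X_def nb_def insert_commute)
      moreover have "n / 4 \<le> d V x"
        using min_degree[of x] that X(1) alpha_pos by fastforce
      ultimately show ?thesis
        using P(4)[of x] that X(2) by fastforce
    qed
    then have "card X * (n / 4 - n / 200 - \<alpha>) \<le> (\<Sum>x\<in>X. d R x)"
      by (intro sum_bounded_below) fastforce
    also have "\<dots> = (\<Sum>w\<in>R. d X w)"
      using X by (intro sum_d_swap) (auto simp: R_def)
    also have "\<dots> \<le> card X * (card R / 2 + n / 10 ^ 4)"
      using X n_pos by (intro sum_d_le_half) (auto simp: R_def)
    finally have "n / 4 - n / 200 - \<alpha> \<le> card R / 2 + n / 10 ^ 4"
      using X(3) n_pos by (smt (verit) mult_le_cancel_left_pos divide_pos_pos)
    moreover have "card R + card (nb (V - P) v) \<le> card (V - P)"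
    proof -
      have "card R + card (nb (V - P) v) = card (R \<union> nb (V - P) v)"
        using finite_V by (intro card_Un_disjoint[symmetric]) (auto simp: R_def nb_def)
      also have "\<dots> \<le> card (V - P)"
        using finite_V by (intro card_mono) (auto simp: R_def nb_def)
      finally show ?thesis .
    qed
    moreover have "d B v \<le> d (V - P) v"
      using B_sub by (intro d_mono) auto
    ultimately show ?thesis
      using cVP P(2) alpha_le n_pos by simp
  qed
  have "A \<union> B = V" "A \<inter> B = {}"
    using B_sub by (auto simp: A_def)
  moreover have "card A \<le> n / 2 + n / 40" "card B \<le> n / 2 + n / 40"
    using cA cB cB' n_pos by simp_all
  ultimately show thesis
    by (rule that[of A B]) (fact ownA ownB)+
qed

section \<open>Contradiction from the bipartition\<close>

text \<open>If \<open>u\<close> had more than \<open>\<alpha>\<close> neighbours on its own side, two of them would be adjacent, and the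
  resulting triangle would have three almost disjoint neighbourhoods of size about \<open>n / 4\<close> on the
  other side.\<close>

lemma own_degree_le:
  assumes "A \<union> B = V" "card B \<le> n / 2 + n / 40"
    and own: "\<And>v. v \<in> A \<Longrightarrow> d A v \<le> n / 25" and "u \<in> A"
  shows "d A u \<le> \<alpha>"
proof (rule ccontr)
  assume "\<not> d A u \<le> \<alpha>"
  then have "\<not> indep (nb A u) E"
    using indep_le[of "nb A u"] assms(1) nb_subset by blast
  then obtain w x where wx: "w \<in> nb A u" "x \<in> nb A u" "{w, x} \<in> E"
    by (auto simp: indep_def)
  have sub: "A \<subseteq> V" "B \<subseteq> V"
    using assms(1) by auto
  have fin: "finite (nb B v)" for v
    using sub(2) nb_subset finite_sub by (meson subset_trans)
  have deg: "d B v \<ge> n / 4 - n / 25" if "v \<in> A" for v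
    using d_subadditive[of V A B v] own[OF that] min_degree[of v] sub assms(1) alpha_pos that
    by fastforce
  have codeg: "card (nb B s \<inter> nb B t) \<le> \<alpha>" if "{s, t} \<in> E" for s t
  proof -
    have "nb B s \<inter> nb B t = nb (nb B s) t"
      by (auto simp: nb_def)
    then show ?thesis
      using d_nb_le[OF sub(2) that] by simp
  qed
  have wxu: "{w, u} \<in> E" "{x, u} \<in> E" "w \<in> A" "x \<in> A"
    using wx by (auto simp: nb_def)
  have "card (nb B w) + card (nb B x) =
      card (nb B w \<union> nb B x) + card (nb B w \<inter> nb B x)"
    by (rule card_Un_Int[OF fin fin])
  moreover have "card (nb B w \<union> nb B x) + card (nb B u) =
      card (nb B w \<union> nb B x \<union> nb B u) + card ((nb B w \<union> nb B x) \<inter> nb B u)"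
    using fin by (intro card_Un_Int) auto
  moreover have "card (nb B w \<union> nb B x \<union> nb B u) \<le> card B"
    using finite_sub[OF sub(2)] by (intro card_mono) (auto simp: nb_def)
  moreover have "card ((nb B w \<union> nb B x) \<inter> nb B u) \<le> card (nb B w \<inter> nb B u) + card (nb B x \<inter> nb B u)"
    by (metis card_Un_le Int_Un_distrib2)
  ultimately have "card (nb B w) + card (nb B x) + card (nb B u) \<le>
      card B + card (nb B w \<inter> nb B x) + card (nb B w \<inter> nb B u) + card (nb B x \<inter> nb B u)"
    by linarith
  then have "d B w + d B x + d B u \<le> card B + real (card (nb B w \<inter> nb B x))
      + real (card (nb B w \<inter> nb B u)) + real (card (nb B x \<inter> nb B u))"
    by linarith
  \<comment> \<open>The left side is 0.63n, but \<open>B\<close> has at most 0.525n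
    vertices.\<close>
  then have "3 * (n / 4 - n / 25) \<le> card B + 3 * \<alpha>"
    using deg[OF wxu(3)] deg[OF wxu(4)] deg[OF assms(4)]
      codeg[OF wx(3)] codeg[OF wxu(1)] codeg[OF wxu(2)]
    by argo
  then show False
    using assms(2) alpha_le n_pos by simp
qed

text \<open>As \<open>A\<close> has more than \<alpha> vertices, some \<open>u\<close> in it is not
  heavy for \<open>B\<close>. Its own-side degree is at most \<alpha>, so the margin 3\<alpha> in
  the minimum degree makes the bound on \<open>card B\<close> strict.\<close>

lemma other_side_large:
  assumes "A \<union> B = V" "card B \<le> n / 2 + n / 40"
    and own: "\<And>v. v \<in> A \<Longrightarrow> d A v \<le> n / 25"
  shows "card B > n / 2"
proof -
  have sub: "A \<subseteq> V" "B \<subseteq> V"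
    using assms(1) by auto
  have "n \<le> card A + card B"
    using card_Un_le[of A B] assms(1) by (simp add: n_def)
  then have cA: "card A > \<alpha>"
    using assms(2) alpha_le n_pos by simp
  have "\<exists>u\<in>A. d B u \<le> (card B + \<alpha>) / 2"
  proof (rule ccontr)
    assume "\<not> ?thesis"
    then have "A \<subseteq> {v \<in> V. d B v > (card B + \<alpha>) / 2}"
      using sub by auto
    then have "card A \<le> card {v \<in> V. d B v > (card B + \<alpha>) / 2}"
      using finite_V by (intro card_mono) auto
    then show False
      using card_heavy_le[OF sub(2)] cA by linarith
  qed
  then obtain u where u: "u \<in> A" "d B u \<le> (card B + \<alpha>) / 2"
    by blast
  have "d V u \<le> d A u + d B u"
    using sub assms(1) by (intro d_subadditive) auto
  moreover have "d A u \<le> \<alpha>"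
    using assms u(1) by (rule own_degree_le)
  ultimately show ?thesis
    using u min_degree[of u] sub alpha_pos by fastforce
qed

lemma contradiction: False
proof -
  obtain A B where AB: "A \<union> B = V" "A \<inter> B = {}"
    "card A \<le> n / 2 + n / 40" "card B \<le> n / 2 + n / 40"
    "\<And>v. v \<in> A \<Longrightarrow> d A v \<le> n / 25" "\<And>v. v \<in> B \<Longrightarrow> d B v \<le> n / 25"
    using ex_sparse_bipartition by metis
  have "card B > n / 2" "card A > n / 2"
    using other_side_large[of A B] other_side_large[of B A] AB by (auto simp: Un_commute)
  moreover have "card A + card B = n"
    using card_Un_disjoint[of A B] AB(1,2) finite_V unfolding n_def by (metis finite_Un)
  ultimately show False
    by linarith
qed

end

section \<open>Edge counts and induction by vertex deletion\<close>

lemma (in K4_free_graph) ex_low_degree: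
  assumes "0 < \<alpha>" "10 ^ 10 * \<alpha> \<le> card V"
  shows "\<exists>v\<in>V. d V v < card V / 4 + 3 * \<alpha>"
proof (rule ccontr)
  assume "\<not> ?thesis"
  then interpret dense_K4_free_graph V E \<alpha> "real (card V)"
    using assms by unfold_locales (auto simp: not_less)
  show False
    by (rule contradiction)
qed

lemma simple_graph_card_le:
  assumes "simple_graph V E"
  shows "2 * real (card E) \<le> real (card V) ^ 2"
proof -
  have "card E \<le> card V choose 2"
    using assms card_mono[of "[V]\<^bsup>2\<^esup>" E] by (simp add: simple_graph_def finite_imp_finite_nsets)
  moreover have "2 * (card V choose 2) \<le> card V * (card V - 1)"
    by (simp add: choose_two)
  moreover have "card V * (card V - 1) \<le> card V ^ 2"
    by (simp add: power2_eq_square)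
  ultimately have "2 * card E \<le> card V ^ 2"
    by linarith
  then show ?thesis
    by (metis of_nat_le_iff of_nat_mult of_nat_numeral of_nat_power)
qed

lemma (in K4_free_graph) card_edges_avoiding:
  "card E = card {e \<in> E. v \<notin> e} + card (nb V v)"
proof -
  have finE: "finite E"
    using simple finite_subset finite_imp_finite_nsets by (metis simple_graph_def)
  have "{e \<in> E. v \<in> e} = (\<lambda>x. {x, v}) ` nb V v"
  proof
    show "{e \<in> E. v \<in> e} \<subseteq> (\<lambda>x. {x, v}) ` nb V v"
    proof
      fix e assume "e \<in> {e \<in> E. v \<in> e}"
      then have e: "e \<in> E" "v \<in> e" "card e = 2"
        using simple by (auto simp: simple_graph_def nsets_def)
      then obtain x where "e = {x, v}"
        by (auto simp: card_2_iff)
      then show "e \<in> (\<lambda>x. {x, v}) ` nb V v"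
        using e(1) edgeD by (auto simp: nb_def)
    qed
  qed (auto simp: nb_def)
  moreover have "inj_on (\<lambda>x. {x, v}) (nb V v)"
    by (auto simp: inj_on_def doubleton_eq_iff)
  ultimately have "card {e \<in> E. v \<in> e} = card (nb V v)"
    by (simp add: card_image)
  moreover have "card ({e \<in> E. v \<notin> e} \<union> {e \<in> E. v \<in> e}) = card {e \<in> E. v \<notin> e} + card {e \<in> E. v \<in> e}"
    using finE by (intro card_Un_disjoint) auto
  moreover have "{e \<in> E. v \<notin> e} \<union> {e \<in> E. v \<in> e} = E"
    by auto
  ultimately show ?thesis
    by simp
qed

theorem theorem1p5:
  fixes \<alpha> :: real and n :: nat and V :: "'a set" and E :: "'a set set"
  assumes "n > 0"
    and "simple_graph V E"
    and "card V = n"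
    and "real (card E) \<ge> real n ^ 2 / 8 + 10 ^ 10 * \<alpha> * real n"
  shows "(\<exists>K\<subseteq>V. card K = 4 \<and> clique K E) \<or> (\<exists>I\<subseteq>V. real (card I) > \<alpha> \<and> indep I E)"
  using assms
proof (induction n arbitrary: V E)
  case 0
  then show ?case
    by simp
next
  case (Suc k)
  show ?case
  proof (rule ccontr)
    assume contra: "\<not> ?case"
    then interpret K4_free_graph V E \<alpha>
      using Suc.prems(2) by unfold_locales (auto simp: not_less)
    define n where "n = real (card V)"
    have n: "n = real k + 1"
      using Suc.prems(3) by (simp add: n_def)
    obtain v where "v \<in> V"
      using Suc.prems(3) by fastforce
    then have "1 \<le> \<alpha>"
      using indep_le[of "{v}"] by (simp add: indep_def)
    have edges: "n ^ 2 / 8 + 10 ^ 10 * \<alpha> * n \<le> card E"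
      using Suc.prems(3,4) by (simp add: n_def)
    \<comment> \<open>Otherwise the linear term alone is at least n^2, more edges than a simple
      graph can have.\<close>
    have large: "10 ^ 10 * \<alpha> < n"
    proof (rule ccontr)
      assume "\<not> ?thesis"
      then have "n * n \<le> 10 ^ 10 * \<alpha> * n"
        using n by (intro mult_right_mono) auto
      moreover have "0 < n * n"
        by (simp add: n)
      ultimately have "2 * real (card E) > n ^ 2"
        using edges \<open>0 < n * n\<close> unfolding power2_eq_square by linarith
      then show False
        using simple_graph_card_le[OF simple] by (simp add: n_def)
    qed
    then obtain v where v: "v \<in> V" "d V v < n / 4 + 3 * \<alpha>"
      using ex_low_degree \<open>1 \<le> \<alpha>\<close> by (auto simp: n_def)
    define F where "F = {e \<in> E. v \<notin> e}"
    have "simple_graph (V - {v}) F"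
      using simple by (auto simp: simple_graph_def F_def nsets_def)
    moreover have "card (V - {v}) = k"
      using v(1) Suc.prems(3) by simp
    moreover have "0 < k"
      using large \<open>1 \<le> \<alpha>\<close> n by simp
    \<comment> \<open>The quadratic term drops by n/4 - 1/8 and the linear one by 10^10 \<alpha>; as
      \<alpha> is at least 1, this covers the lost degree, below n/4 + 3\<alpha>.\<close>
    moreover have "real (card F) \<ge> real k ^ 2 / 8 + 10 ^ 10 * \<alpha> * real k"
    proof -
      have "real (card F) = card E - d V v"
        using card_edges_avoiding[of v] by (simp add: F_def)
      moreover have "n ^ 2 / 8 - n / 4 \<ge> real k ^ 2 / 8 - 1 / 8"
        by (simp add: n power2_eq_square field_simps)
      moreover have "10 ^ 10 * \<alpha> * n = 10 ^ 10 * \<alpha> * real k + 10 ^ 10 * \<alpha>"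
        by (simp add: n algebra_simps)
      moreover have "3 * \<alpha> + 1 \<le> 10 ^ 10 * \<alpha>"
        using \<open>1 \<le> \<alpha>\<close> by simp
      ultimately show ?thesis
        using edges v(2) by linarith
    qed
    ultimately have IH: "(\<exists>K\<subseteq>V - {v}. card K = 4 \<and> clique K F) \<or>
        (\<exists>I\<subseteq>V - {v}. real (card I) > \<alpha> \<and> indep I F)"
      by (intro Suc.IH)
    have "clique K E" if "clique K F" for K
      using that by (auto simp: clique_def F_def)
    moreover have "indep I E" if "indep I F" "I \<subseteq> V - {v}" for I
      using that by (auto simp: indep_def F_def)
    ultimately show False
      using IH contra by (meson Diff_subset subset_trans)
  qed
qed

end
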